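(* Let $G$ be a hyperbolic random graph and let $\varphi = \varphi(n) = \Omega(n^{1-1/\alpha}\log n)$. With high probability, for every sector of angular width $\varphi$, the degrees of the vertices of $G$ lying in that sector sum to $\tilde{\mathcal O}(\varphi n + \delta_{\max})$.
   Context: Hyperbolic random graphs: fix constants $\alpha\in(1/2,1)$ and $C\in\mathbb R$, let $n$ be the number of vertices and $R = 2\log n + C$ (natural logarithm). Each of the $n$ vertices is placed independently at a random point of the disk of radius $R$ around a fixed origin $O$ of the hyperbolic plane, in polar coordinates $(r,\varphi)$: angle uniform in $[0,2\pi)$ and radius with density $\alpha\sinh(\alpha r)/(\cosh(\alpha R)-1)$ on $[0,R]$. The hyperbolic distance $d$ between $(r_1,\varphi_1)$ and $(r_2,\varphi_2)$ satisfies $\cosh d = \cosh r_1\cosh r_2 - \sinh r_1\sinh r_2\cos(\Delta)$ with $\Delta = \pi - |\pi - |\varphi_1-\varphi_2||$. Two vertices are adjacent iff their distance is less than $R$. A sector of angular width $\varphi$ is the set of points of the disk of radius $R$ whose angular coordinate lies in a fixed interval of length $\varphi$. $\delta_{\max}$ is the maximum degree of $G$. Asymptotics are as $n\to\infty$ with $\alpha,C$ fixed; "with high probability" means with probability $1-O(1/n)$; $\tilde{\mathcal O}$ suppresses polylogarithmic factors in $n$. *)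

theory Defs
  imports "HOL-Probability.Probability" "HOL-Library.Landau_Symbols"
begin

text \<open>
  Points of the disk are given by polar coordinates \<open>(r, \<theta>)\<close>, and the vertices of a graph on
  \<open>n\<close> vertices are the indices \<open>i < n\<close>; a sample \<open>\<omega>\<close> assigns to each index its position.
\<close>

type_synonym polar = "real \<times> real"

definition hrg_radius :: "real \<Rightarrow> nat \<Rightarrow> real" where
  "hrg_radius C n = 2 * ln (real n) + C"

definition radial_measure :: "real \<Rightarrow> real \<Rightarrow> real measure" where
  "radial_measure \<alpha> R = density lborel
     (\<lambda>r. ennreal (\<alpha> * sinh (\<alpha> * r) / (cosh (\<alpha> * R) - 1) * indicator {0..R} r))"

definition angular_measure :: "real measure" where
  "angular_measure = uniform_measure lborel {0..<2 * pi}"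

text \<open>
  If \<open>hrg_radius C n \<le> 0\<close>, which happens for at most finitely many \<open>n\<close>, the following is not a
  probability measure; this is irrelevant for the asymptotic statements made here.
\<close>

definition hrg_measure :: "real \<Rightarrow> real \<Rightarrow> nat \<Rightarrow> (nat \<Rightarrow> polar) measure" where
  "hrg_measure \<alpha> C n =
     PiM {..<n} (\<lambda>_. radial_measure \<alpha> (hrg_radius C n) \<Otimes>\<^sub>M angular_measure)"

definition angle_diff :: "real \<Rightarrow> real \<Rightarrow> real" where
  "angle_diff \<theta>1 \<theta>2 = pi - \<bar>pi - \<bar>\<theta>1 - \<theta>2\<bar>\<bar>"

text \<open>
  For radii \<open>\<ge> 0\<close> the argument of \<^const>\<open>arcosh\<close> is at least \<open>cosh (r1 - r2) \<ge> 1\<close>.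
\<close>

definition hyp_dist :: "polar \<Rightarrow> polar \<Rightarrow> real" where
  "hyp_dist p q = arcosh (cosh (fst p) * cosh (fst q)
     - sinh (fst p) * sinh (fst q) * cos (angle_diff (snd p) (snd q)))"

definition hrg_adj :: "real \<Rightarrow> (nat \<Rightarrow> polar) \<Rightarrow> nat \<Rightarrow> nat \<Rightarrow> bool" where
  "hrg_adj R \<omega> i j \<longleftrightarrow> i \<noteq> j \<and> hyp_dist (\<omega> i) (\<omega> j) < R"

definition hrg_degree :: "real \<Rightarrow> nat \<Rightarrow> (nat \<Rightarrow> polar) \<Rightarrow> nat \<Rightarrow> nat" where
  "hrg_degree C n \<omega> i = card {j. j < n \<and> hrg_adj (hrg_radius C n) \<omega> i j}"

definition hrg_max_degree :: "real \<Rightarrow> nat \<Rightarrow> (nat \<Rightarrow> polar) \<Rightarrow> nat" where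
  "hrg_max_degree C n \<omega> = Max (hrg_degree C n \<omega> ` {..<n})"

text \<open>
  The sector of the disk of radius \<open>R\<close> that starts at angle \<open>a\<close> and has angular width \<open>w\<close>.
  Angular coordinates lie in \<open>[0, 2\<pi>)\<close> and are read modulo \<open>2\<pi>\<close>, so a sector may cross the
  ray of angle \<open>0\<close>.
\<close>

definition sector :: "real \<Rightarrow> real \<Rightarrow> real \<Rightarrow> polar set" where
  "sector R a w = {(r, \<theta>). 0 \<le> r \<and> r \<le> R \<and> 0 \<le> \<theta> \<and> \<theta> < 2 * pi \<and>
     (\<exists>k::int. a \<le> \<theta> + 2 * pi * of_int k \<and> \<theta> + 2 * pi * of_int k \<le> a + w)}"

definition sector_degree_sum ::
  "real \<Rightarrow> nat \<Rightarrow> (nat \<Rightarrow> polar) \<Rightarrow> real \<Rightarrow> real \<Rightarrow> nat" where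
  "sector_degree_sum C n \<omega> a w =
     (\<Sum>i | i < n \<and> \<omega> i \<in> sector (hrg_radius C n) a w. hrg_degree C n \<omega> i)"

text \<open>
  With probability \<open>1 - O(1/n)\<close>. Stated via the probability of success, since a non-measurable
  set has \<^const>\<open>measure\<close> \<open>0\<close>: in this form the event cannot fail to be measurable for
  infinitely many \<open>n\<close>.
\<close>

definition whp :: "(nat \<Rightarrow> 'a measure) \<Rightarrow> (nat \<Rightarrow> 'a \<Rightarrow> bool) \<Rightarrow> bool" where
  "whp M P \<longleftrightarrow>
     (\<lambda>n. 1 - measure (M n) {\<omega> \<in> space (M n). P n \<omega>}) \<in> O(\<lambda>n. 1 / real n)"

text \<open>
  For random variables \<open>X n\<close> and \<open>Y n\<close>, the family \<open>X n i\<close> with \<open>i \<in> I\<close> is, with high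
  probability, simultaneously bounded by \<open>Y n\<close> up to a factor polylogarithmic in \<open>n\<close>. The
  constants of the factor are deterministic and do not depend on \<open>n\<close>, \<open>i\<close> or the sample.
\<close>

definition whp_soft_O ::
  "(nat \<Rightarrow> 'a measure) \<Rightarrow> 'i set \<Rightarrow> (nat \<Rightarrow> 'i \<Rightarrow> 'a \<Rightarrow> real) \<Rightarrow> (nat \<Rightarrow> 'a \<Rightarrow> real) \<Rightarrow> bool" where
  "whp_soft_O M I X Y \<longleftrightarrow> (\<exists>(K::real) (k::nat).
     whp M (\<lambda>n \<omega>. \<forall>i\<in>I. \<bar>X n i \<omega>\<bar> \<le> K * ln (real n) ^ k * \<bar>Y n \<omega>\<bar>))"

end

theory Submission
  imports Defs "HOL-Analysis.Harmonic_Numbers"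
begin

text \<open>
  Up to logarithmic factors, a vertex of radius \<open>r\<close> has degree at most \<open>exp ((R - r) / 2)\<close> with high
  probability: the radial density at \<open>s\<close> is at most \<open>4 exp ((s - R) / 2)\<close>, two points of radii \<open>r\<close>
  and \<open>s\<close> are adjacent with probability \<open>O(exp ((R - r - s) / 2))\<close>, and the dependence on \<open>s\<close> cancels,
  so that integrating over \<open>s\<close> costs a factor \<open>R\<close> only. Hence a vertex of degree at least \<open>d\<close> satisfies
  \<open>exp ((R - r) / 2) \<ge> d\<close> up to logarithmic factors, and by the same cancellation a given sector of
  width \<open>w\<close> contains \<open>O(w n / d + 1)\<close> of them, again up to logarithmic factors. Summing over
  \<open>d = 1, \<dots>, \<delta>\<^sub>m\<^sub>a\<^sub>x\<close> gives the degree sum, the harmonic series contributing another logarithm.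
\<close>

section \<open>Elementary bounds for trigonometric and hyperbolic functions\<close>

lemma sin_ge_third:
  fixes x :: real
  assumes "0 \<le> x" "x \<le> pi / 2"
  shows "x / 3 \<le> sin x"
proof -
  have "\<bar>sin x - (\<Sum>m<3. sin_coeff m * x ^ m)\<bar> \<le> inverse (fact 3) * \<bar>x\<bar> ^ 3"
    by (rule Maclaurin_sin_bound)
  hence "\<bar>sin x - x\<bar> \<le> x ^ 3 / 6"
    using assms by (simp add: sin_coeff_def eval_nat_numeral)
  \<comment> \<open>As \<open>x < 2\<close>, the cubic error \<open>x ^ 3 / 6\<close> is at most
    \<open>2 * x / 3\<close>, which leaves a third of \<open>x\<close>.\<close>
  moreover have "x ^ 3 \<le> 4 * x"
  proof -
    have "x * x \<le> 2 * 2"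
      using assms pi_half_less_two by (intro mult_mono) auto
    from mult_left_mono[OF this assms(1)] show ?thesis
      by (simp add: power3_eq_cube mult_ac)
  qed
  ultimately show ?thesis by linarith
qed

text \<open>The half-angle formula reduces this to the linear bound on the sine. Being quadratic in
  the angle, it lets the hyperbolic law of cosines control the angle between adjacent
  points.\<close>

lemma one_minus_cos_ge:
  fixes x :: real
  assumes "0 \<le> x" "x \<le> pi"
  shows "x\<^sup>2 / 18 \<le> 1 - cos x"
proof -
  have "(x / 6)\<^sup>2 \<le> (sin (x / 2))\<^sup>2"
    using sin_ge_third[of "x / 2"] assms by (intro power_mono) auto
  moreover have "cos x = 1 - 2 * (sin (x / 2))\<^sup>2"
    using cos_double_sin[of "x / 2"] by simp
  ultimately show ?thesis by (simp add: power_divide)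
qed

lemma sinh_ge_exp:
  fixes x :: real
  assumes "1 \<le> x"
  shows "exp x / 4 \<le> sinh x"
proof -
  have "2 \<le> exp x" using exp_ge_add_one_self[of x] assms by linarith
  moreover have "exp x / 4 \<le> (exp x - y) / 2" if "2 \<le> exp x" "y \<le> 1" for y :: real
    using that by (simp add: field_simps)
  moreover have "exp (-x) \<le> 1" using assms by simp
  ultimately have "exp x / 4 \<le> (exp x - exp (-x)) / 2" by blast
  thus ?thesis by (simp only: sinh_field_def)
qed

lemma cosh_minus_one_ge_exp:
  fixes x :: real
  assumes "1 \<le> x"
  shows "exp x / 8 \<le> cosh x - 1"
proof -
  have "2 * exp (-(x/2)) \<le> exp (x/2)"
  proof -
    have "2 \<le> exp x" using exp_ge_add_one_self[of x] assms by linarith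
    hence "2 * exp (-(x/2)) \<le> exp x * exp (-(x/2))" by (intro mult_right_mono) auto
    thus ?thesis by (simp flip: exp_add)
  qed
  \<comment> \<open>\<open>cosh x - 1\<close> is half the square of
    \<open>exp (x/2) - exp (-(x/2))\<close>, whose second term is at most half of the first because
    \<open>exp x \<ge> 2\<close>.\<close>
  hence "(exp (x/2) / 2)\<^sup>2 \<le> (exp (x/2) - exp (-(x/2)))\<^sup>2"
    by (intro power_mono) auto
  also have "\<dots> = 2 * (cosh x - 1)"
    by (simp add: cosh_field_def power2_eq_square algebra_simps flip: exp_add)
  finally show ?thesis by (simp add: power_divide power2_eq_square flip: exp_add)
qed

section \<open>The distribution of a single point\<close>

lemma sinh_measurable [measurable]: "(sinh :: real \<Rightarrow> real) \<in> borel_measurable borel"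
  by (intro borel_measurable_continuous_onI continuous_intros)

text \<open>Exponential bounds on numerator and denominator give
  \<open>4 * exp (\<alpha> * (s - R))\<close>; since \<open>s - R\<close> is nonpositive, \<alpha>
  may be lowered to 1/2. This rate is the one that cancels against the factor
  \<open>exp ((R - s) / 2)\<close> of the slice bounds.\<close>

lemma radial_density_le:
  fixes \<alpha> R s :: real
  assumes \<alpha>: "1 / 2 < \<alpha>" "\<alpha> < 1" and R: "2 \<le> R" and s: "0 \<le> s" "s \<le> R"
  shows "\<alpha> * sinh (\<alpha> * s) / (cosh (\<alpha> * R) - 1) \<le> 4 * exp ((s - R) / 2)"
proof -
  \<comment> \<open>This yields \<open>1 \<le> \<alpha> * R\<close>, the range in which the bound on
    \<open>cosh\<close> holds.\<close>
  have "1 / 2 * 2 \<le> \<alpha> * R" using \<alpha> R by (intro mult_mono) auto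
  hence c: "exp (\<alpha> * R) / 8 \<le> cosh (\<alpha> * R) - 1" by (intro cosh_minus_one_ge_exp) simp
  have "\<alpha> * sinh (\<alpha> * s) / (cosh (\<alpha> * R) - 1) \<le> (1 * (exp (\<alpha> * s) / 2)) / (exp (\<alpha> * R) / 8)"
  proof (rule frac_le)
    show "\<alpha> * sinh (\<alpha> * s) \<le> 1 * (exp (\<alpha> * s) / 2)"
      using \<alpha> s by (intro mult_mono) (auto simp: sinh_field_def)
  qed (use c in auto)
  also have "\<dots> = 4 * exp (\<alpha> * (s - R))" by (simp add: right_diff_distrib exp_diff)
  also have "\<alpha> * (s - R) \<le> 1 / 2 * (s - R)"
    using \<alpha> s by (intro mult_right_mono_neg) auto
  finally show ?thesis by simp
qed

lemma sets_radial_measure [measurable_cong, simp]: "sets (radial_measure \<alpha> R) = sets borel"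
  by (simp add: radial_measure_def)

lemma sets_angular_measure [measurable_cong, simp]: "sets angular_measure = sets borel"
  by (simp add: angular_measure_def)

lemma prob_space_angular: "prob_space angular_measure"
  unfolding angular_measure_def by (rule prob_space_uniform_measure) auto

lemma prob_space_radial:
  assumes "0 < \<alpha>" "0 < R"
  shows "prob_space (radial_measure \<alpha> R)"
proof
  have c: "cosh (\<alpha> * R) > 1"
    using cosh_real_strict_mono[of 0 "\<alpha> * R"] assms by simp
  let ?f = "\<lambda>r. \<alpha> * sinh (\<alpha> * r) / (cosh (\<alpha> * R) - 1)"
  let ?F = "\<lambda>r. cosh (\<alpha> * r) / (cosh (\<alpha> * R) - 1)"
  have "emeasure (radial_measure \<alpha> R) (space (radial_measure \<alpha> R)) =
      (\<integral>\<^sup>+r. ennreal (?f r) * indicator {0..R} r \<partial>lborel)"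
    unfolding radial_measure_def
    by (subst emeasure_density) (auto intro!: nn_integral_cong split: split_indicator)
  also have "\<dots> = ennreal (?F R - ?F 0)"
  proof (rule nn_integral_FTC_Icc)
    show "(?F has_real_derivative ?f x) (at x)" for x
      using c by (auto intro!: derivative_eq_intros)
    show "0 \<le> ?f x" if "x \<in> {0..R}" for x
      using that assms c by auto
  qed (use assms in auto)
  also have "?F R - ?F 0 = 1" using c assms by (simp flip: diff_divide_distrib)
  finally show "emeasure (radial_measure \<alpha> R) (space (radial_measure \<alpha> R)) = 1" by simp
qed

abbreviation point_measure :: "real \<Rightarrow> real \<Rightarrow> polar measure" where
  "point_measure \<alpha> R \<equiv> radial_measure \<alpha> R \<Otimes>\<^sub>M angular_measure"

text \<open>The growth \<open>exp ((R - s) / 2)\<close> allowed for a slice is, up to the factor 4,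
  the reciprocal of the density bound, so the integrand is at most \<open>4 * b\<close> on an
  interval of length \<open>R\<close>. The degree estimate and the sector estimate both rest on this
  cancellation.\<close>

lemma emeasure_point_measure_le:
  fixes \<alpha> R b :: real
  assumes \<alpha>: "1 / 2 < \<alpha>" "\<alpha> < 1" and R: "2 \<le> R" and b: "0 \<le> b"
    and A [measurable]: "A \<in> sets (borel \<Otimes>\<^sub>M borel)"
    and slice: "\<And>s. 0 \<le> s \<Longrightarrow> s \<le> R \<Longrightarrow>
      emeasure angular_measure (Pair s -` A) \<le> ennreal (b * exp ((R - s) / 2))"
  shows "emeasure (point_measure \<alpha> R) A \<le> ennreal (4 * b * R)"
proof -
  interpret a: prob_space angular_measure by (rule prob_space_angular)
  have A' [measurable]: "A \<in> sets (point_measure \<alpha> R)"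
    using A by (simp cong: sets_pair_measure_cong)
  let ?f = "\<lambda>s. \<alpha> * sinh (\<alpha> * s) / (cosh (\<alpha> * R) - 1)"
  have "emeasure (point_measure \<alpha> R) A =
      (\<integral>\<^sup>+s. emeasure angular_measure (Pair s -` A) \<partial>radial_measure \<alpha> R)"
    by (rule a.emeasure_pair_measure_alt) measurable
  also have "\<dots> = (\<integral>\<^sup>+s. ennreal (?f s * indicator {0..R} s) *
      emeasure angular_measure (Pair s -` A) \<partial>lborel)"
    unfolding radial_measure_def
    using a.measurable_emeasure_Pair[OF A']
    by (subst nn_integral_density) (auto simp: radial_measure_def)
  also have "\<dots> \<le> (\<integral>\<^sup>+s. ennreal (4 * b) * indicator {0..R} s \<partial>lborel)"
  proof (rule nn_integral_mono)
    fix s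
    show "ennreal (?f s * indicator {0..R} s) * emeasure angular_measure (Pair s -` A)
        \<le> ennreal (4 * b) * indicator {0..R} s"
    proof (cases "s \<in> {0..R}")
      case True
      hence s: "0 \<le> s" "s \<le> R" by auto
      have "ennreal (?f s) * emeasure angular_measure (Pair s -` A)
          \<le> ennreal (4 * exp ((s - R) / 2)) * ennreal (b * exp ((R - s) / 2))"
        using radial_density_le[OF \<alpha> R s] slice[OF s] by (intro mult_mono ennreal_leI) auto
      also have "\<dots> = ennreal (4 * b * (exp ((s - R) / 2) * exp ((R - s) / 2)))"
        using b by (simp add: mult_ac flip: ennreal_mult)
      also have "exp ((s - R) / 2) * exp ((R - s) / 2) = 1"
        by (simp add: diff_divide_distrib flip: exp_add)
      finally show ?thesis using True by simp
    qed auto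
  qed
  also have "\<dots> = ennreal (4 * b * R)"
    using b R by (subst nn_integral_cmult_indicator) (auto simp flip: ennreal_mult)
  finally show ?thesis .
qed

section \<open>Angular measure of sectors\<close>

definition sector_angles :: "real \<Rightarrow> real \<Rightarrow> real set" where
  "sector_angles a w = {t. 0 \<le> t \<and> t < 2 * pi \<and>
     (\<exists>k::int. a \<le> t + 2 * pi * of_int k \<and> t + 2 * pi * of_int k \<le> a + w)}"

lemma sets_sector_angles [measurable]: "sector_angles a w \<in> sets borel"
  unfolding sector_angles_def by measurable

lemma emeasure_angular_eq:
  assumes [measurable]: "A \<in> sets borel"
  shows "emeasure angular_measure A = emeasure lborel ({0..<2 * pi} \<inter> A) / ennreal (2 * pi)"
  unfolding angular_measure_def by (subst emeasure_uniform_measure) auto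

text \<open>A window narrower than a full turn meets at most two consecutive periods. Counting
  \<open>w\<close> in full for both loses a factor 2 against \<open>w / (2 * pi)\<close>, which is
  harmless; wider windows are covered by total mass one.\<close>

lemma emeasure_angular_sector_angles_le:
  assumes "0 \<le> w"
  shows "emeasure angular_measure (sector_angles a w) \<le> ennreal (w / pi)"
proof (cases "w < 2 * pi")
  case False
  interpret a: prob_space angular_measure by (rule prob_space_angular)
  have "emeasure angular_measure (sector_angles a w) \<le> ennreal 1"
    using a.emeasure_le_1 by simp
  also have "\<dots> \<le> ennreal (w / pi)" using False by (intro ennreal_leI) (simp add: field_simps, use pi_gt_zero in linarith)
  finally show ?thesis .
next
  case True
  \<comment> \<open>\<open>m\<close> numbers the period that contains \<open>a\<close>; only the
    windings \<open>m\<close> and \<open>m + 1\<close> can occur.\<close>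
  define m where "m = \<lfloor>a / (2 * pi)\<rfloor>"
  have m: "of_int m * (2 * pi) \<le> a" "a < (of_int m + 1) * (2 * pi)"
    unfolding m_def by (metis divide_le_eq floor_divide_lower pi_gt_zero zero_less_mult_iff zero_less_numeral)
      (simp add: floor_divide_upper)
  define I where "I = (\<lambda>k::int. {a - 2 * pi * of_int k .. a + w - 2 * pi * of_int k})"
  have sub: "{0..<2 * pi} \<inter> sector_angles a w \<subseteq> I m \<union> I (m + 1)"
  proof
    fix t assume "t \<in> {0..<2 * pi} \<inter> sector_angles a w"
    then obtain k :: int where t: "0 \<le> t" "t < 2 * pi"
      and k: "a \<le> t + 2 * pi * of_int k" "t + 2 * pi * of_int k \<le> a + w"
      by (auto simp: sector_angles_def)
    have "2 * pi * of_int m < 2 * pi * (of_int k + 1)"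
      using m t k by (simp add: algebra_simps)
    hence "real_of_int m < real_of_int k + 1" by simp
    hence "m \<le> k" by linarith
    have "2 * pi * of_int k < 2 * pi * (of_int m + 2)"
      using m t k True by (simp add: algebra_simps)
    hence "real_of_int k < real_of_int m + 2" by simp
    hence "k \<le> m + 1" by linarith
    with \<open>m \<le> k\<close> have "k = m \<or> k = m + 1" by auto
    thus "t \<in> I m \<union> I (m + 1)" using k by (auto simp: I_def)
  qed
  have "emeasure lborel ({0..<2 * pi} \<inter> sector_angles a w) \<le> emeasure lborel (I m \<union> I (m + 1))"
    using sub by (rule emeasure_mono) (simp add: I_def)
  also have "\<dots> \<le> emeasure lborel (I m) + emeasure lborel (I (m + 1))"
    by (rule emeasure_subadditive) (simp_all add: I_def)
  also have "\<dots> = ennreal (2 * w)"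
    using assms by (simp add: I_def flip: ennreal_plus)
  finally have "emeasure angular_measure (sector_angles a w) \<le> ennreal (2 * w) / ennreal (2 * pi)"
    by (subst emeasure_angular_eq) (auto intro: divide_right_mono_ennreal)
  also have "\<dots> = ennreal (w / pi)"
    using assms by (subst divide_ennreal) auto
  finally show ?thesis .
qed

section \<open>Angles between adjacent points\<close>

lemma angle_diff_le_imp_sector_angles:
  assumes "0 \<le> u" "u < 2 * pi" "0 \<le> t" "t < 2 * pi" "angle_diff u t \<le> x"
  shows "t \<in> sector_angles (u - x) (2 * x)"
proof -
  \<comment> \<open>\<open>angle_diff\<close> is the distance on the circle, so the angles are close
    either directly or after a full turn in one of the two directions.\<close>
  have "(u - x \<le> t \<and> t \<le> u + x) \<or> (u - x \<le> t + 2 * pi \<and> t + 2 * pi \<le> u + x)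
      \<or> (u - x \<le> t - 2 * pi \<and> t - 2 * pi \<le> u + x)"
    using assms unfolding angle_diff_def by linarith
  hence "\<exists>k::int. u - x \<le> t + 2 * pi * of_int k \<and> t + 2 * pi * of_int k \<le> u + x"
  proof (elim disjE)
  qed (rule exI[of _ 0], simp, rule exI[of _ 1], simp, rule exI[of _ "-1"], simp)
  thus ?thesis using assms by (auto simp: sector_angles_def)
qed

lemma hyp_dist_measurable [measurable]:
  assumes [measurable]: "f \<in> M \<rightarrow>\<^sub>M borel \<Otimes>\<^sub>M borel" "g \<in> M \<rightarrow>\<^sub>M borel \<Otimes>\<^sub>M borel"
  shows "(\<lambda>x. hyp_dist (f x) (g x)) \<in> borel_measurable M"
  unfolding hyp_dist_def arcosh_def angle_diff_def cosh_field_def sinh_field_def by measurable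

text \<open>The law of cosines reads
  \<open>cosh (r - s) + sinh r * sinh s * (1 - cos D) < cosh R\<close>. Dropping the positive first
  summand and bounding the three remaining factors from below leaves a quadratic inequality for
  \<open>D\<close>.\<close>

lemma hyp_dist_less_imp_angle_diff:
  assumes r: "1 \<le> r" and s: "1 \<le> s" and R: "0 \<le> R"
    and uv: "0 \<le> u" "u < 2 * pi" "0 \<le> v" "v < 2 * pi"
    and d: "hyp_dist (r, u) (s, v) < R"
  shows "angle_diff u v \<le> 17 * exp ((R - r - s) / 2)"
proof -
  define D where "D = angle_diff u v"
  have D: "0 \<le> D" "D \<le> pi" using uv unfolding D_def angle_diff_def by linarith+
  let ?x = "cosh r * cosh s - sinh r * sinh s * cos D"
  have x: "?x = cosh (r - s) + sinh r * sinh s * (1 - cos D)"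
    by (simp add: cosh_diff algebra_simps)
  have nn: "0 \<le> sinh r * sinh s" using r s by simp
  \<comment> \<open>The comparison of \<open>arcosh\<close> values can be undone only for arguments
    that are at least one.\<close>
  have "1 \<le> ?x"
    unfolding x using nn cosh_real_ge_1[of "r - s"] by (smt (verit) cos_le_one mult_nonneg_nonneg)
  moreover have "arcosh ?x < arcosh (cosh R)"
    using d R by (simp add: hyp_dist_def D_def arcosh_cosh_real)
  ultimately have "?x < cosh R" by (simp add: cosh_real_ge_1)
  hence "sinh r * sinh s * (1 - cos D) \<le> cosh R"
    unfolding x using cosh_real_ge_1[of "r - s"] by linarith
  also have "cosh R \<le> exp R"
    using R unfolding cosh_field_def by (simp add: field_simps)
  finally have *: "sinh r * sinh s * (1 - cos D) \<le> exp R" .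
  have "exp r / 4 * (exp s / 4) * (D\<^sup>2 / 18) \<le> sinh r * sinh s * (1 - cos D)"
    using sinh_ge_exp[OF r] sinh_ge_exp[OF s] one_minus_cos_ge[OF D] r s
    by (intro mult_mono) auto
  with * have "exp (r + s) * D\<^sup>2 \<le> 288 * exp R" by (simp add: exp_add)
  hence "exp (-(r + s)) * (exp (r + s) * D\<^sup>2) \<le> exp (-(r + s)) * (288 * exp R)"
    by (intro mult_left_mono) auto
  hence "D\<^sup>2 \<le> 288 * exp (R - r - s)"
    by (simp add: mult.assoc[symmetric] flip: exp_add) (simp add: exp_diff exp_minus exp_add field_simps)
  \<comment> \<open>The constant is 288 = 4 * 4 * 18, and 17 is the least integer whose square, 289,
    exceeds it.\<close>
  also have "\<dots> \<le> (17 * exp ((R - r - s) / 2))\<^sup>2"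
    by (simp add: power_mult_distrib power2_eq_square flip: exp_add)
  finally show ?thesis unfolding D_def by (rule power2_le_imp_le) simp
qed

lemma emeasure_angular_adjacent_le:
  assumes r: "0 \<le> r" "r \<le> R" and s: "0 \<le> s" "s \<le> R" and u: "0 \<le> u" "u < 2 * pi"
  shows "emeasure angular_measure {v. hyp_dist (r, u) (s, v) < R}
    \<le> ennreal (12 * exp ((R - r - s) / 2))"
proof (cases "1 \<le> r \<and> 1 \<le> s")
  \<comment> \<open>One radius is below 1 and the other at most \<open>R\<close>, so
    \<open>R - r - s > -1\<close>; the claimed bound then exceeds one.\<close>
  case False
  interpret a: prob_space angular_measure by (rule prob_space_angular)
  have "1 / 2 \<le> exp (-1/2::real)"
    using exp_ge_add_one_self[of "-1/2::real"] by simp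
  also have "\<dots> \<le> exp ((R - r - s) / 2)" using False r s by (subst exp_le_cancel_iff) (auto simp: not_le)
  finally have "ennreal 1 \<le> ennreal (12 * exp ((R - r - s) / 2))" by (intro ennreal_leI) simp
  thus ?thesis by (intro order.trans[OF a.emeasure_le_1]) simp
next
  case True
  let ?x = "17 * exp ((R - r - s) / 2)"
  have "v \<in> sector_angles (u - ?x) (2 * ?x)"
    if "v \<in> {0..<2*pi} \<inter> {v. hyp_dist (r, u) (s, v) < R}" for v
    using that True r u hyp_dist_less_imp_angle_diff[of r s R u v]
    by (intro angle_diff_le_imp_sector_angles) auto
  note sub = subsetI[OF this]
  have "emeasure angular_measure {v. hyp_dist (r, u) (s, v) < R}
      = emeasure angular_measure ({0..<2*pi} \<inter> {v. hyp_dist (r, u) (s, v) < R})"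
    by (subst (1 2) emeasure_angular_eq) (auto simp: Int_assoc[symmetric])
  also have "\<dots> \<le> emeasure angular_measure (sector_angles (u - ?x) (2 * ?x))"
    by (rule emeasure_mono[OF sub]) measurable
  also have "\<dots> \<le> ennreal ((2 * ?x) / pi)" by (rule emeasure_angular_sector_angles_le) simp
  also have "\<dots> \<le> ennreal (12 * exp ((R - r - s) / 2))"
  proof (rule ennreal_leI)
    \<comment> \<open>The window has width 34 times the exponential, and 34 / 3 < 12.\<close>
    have "2 * ?x / pi \<le> 2 * ?x / 3" using pi_gt3 by (intro divide_left_mono) auto
    also have "2 * ?x / 3 \<le> 12 * exp ((R - r - s) / 2)" by simp
    finally show "2 * ?x / pi \<le> 12 * exp ((R - r - s) / 2)" .
  qed
  finally show ?thesis .
qed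

section \<open>A conditional Chernoff bound\<close>

lemma (in prob_space) nn_integral_exp_indicator_le:
  assumes [measurable]: "A \<in> sets M" and p: "emeasure M A \<le> ennreal p" "0 \<le> p"
  shows "(\<integral>\<^sup>+y. ennreal (exp (indicator A y)) \<partial>M) \<le> ennreal (exp (2 * p))"
proof -
  have "(\<integral>\<^sup>+y. ennreal (exp (indicator A y)) \<partial>M) \<le> (\<integral>\<^sup>+y. 1 + 2 * indicator A y \<partial>M)"
  proof (rule nn_integral_mono)
    fix y
    \<comment> \<open>As \<open>exp 1 \<le> 3\<close>, the line \<open>1 + 2 * x\<close> dominates
      \<open>exp x\<close> at both values 0 and 1 of the indicator.\<close>
    have "ennreal (exp (indicator A y)) \<le> ennreal (1 + 2 * indicator A y)"
      using exp_le by (intro ennreal_leI) (auto split: split_indicator)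
    thus "ennreal (exp (indicator A y)) \<le> 1 + 2 * indicator A y"
      by (cases "y \<in> A") simp_all
  qed
  also have "\<dots> = 1 + 2 * emeasure M A"
    by (subst nn_integral_add) (auto simp: nn_integral_cmult emeasure_space_1)
  also have "\<dots> \<le> 1 + 2 * ennreal p"
    using p by (intro add_left_mono mult_left_mono) auto
  also have "\<dots> = ennreal (1 + 2 * p)"
    using p by (simp add: ennreal_plus ennreal_mult)
  also have "\<dots> \<le> ennreal (exp (2 * p))"
    by (intro ennreal_leI exp_ge_add_one_self)
  finally show ?thesis .
qed

text \<open>
  Chernoff bound conditionally on point \<open>i\<close>, given which the other points are still independent.
\<close>

lemma (in prob_space) prob_count_related_ge:
  fixes p :: "'a \<Rightarrow> real"
  assumes i: "i < n"
    and Q [measurable]: "Measurable.pred (M \<Otimes>\<^sub>M M) (\<lambda>(x, y). Q x y)"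
    and p [measurable]: "p \<in> borel_measurable M"
    and p_nonneg: "\<And>x. 0 \<le> p x"
    and le: "\<And>x. x \<in> space M \<Longrightarrow> emeasure M {y \<in> space M. Q x y} \<le> ennreal (p x)"
  defines "N \<equiv> PiM {..<n} (\<lambda>_. M)"
  shows "{\<omega> \<in> space N. 2 * real n * p (\<omega> i) + t \<le> real (card {j. j < n \<and> j \<noteq> i \<and> Q (\<omega> i) (\<omega> j)})} \<in> sets N"
    and "measure N {\<omega> \<in> space N. 2 * real n * p (\<omega> i) + t \<le>
      real (card {j. j < n \<and> j \<noteq> i \<and> Q (\<omega> i) (\<omega> j)})} \<le> exp (- t)"
proof -
  interpret P: product_sigma_finite "\<lambda>_. M" by standard
  interpret N: prob_space N unfolding N_def by (intro prob_space_PiM) unfold_locales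
  define I where "I = {..<n} - {i}"
  have I: "finite I" "i \<notin> I" "insert i I = {..<n}" using i by (auto simp: I_def)
  have cardI: "card I \<le> n" using i by (simp add: I_def)
  define A where "A = (\<lambda>x. {y \<in> space M. Q x y})"
  have A [measurable]: "x \<in> space M \<Longrightarrow> A x \<in> sets M" for x unfolding A_def by measurable
  define cnt where "cnt = (\<lambda>\<omega>. \<Sum>j\<in>I. indicator (A (\<omega> i)) (\<omega> j) :: real)"
  have card_eq: "real (card {j. j < n \<and> j \<noteq> i \<and> Q (\<omega> i) (\<omega> j)}) = cnt \<omega>" if "\<omega> \<in> space N" for \<omega>
  proof -
    have "\<omega> j \<in> space M" if "j < n" for j
      using \<open>\<omega> \<in> space N\<close> that by (auto simp: N_def space_PiM)
    hence "{j. j < n \<and> j \<noteq> i \<and> Q (\<omega> i) (\<omega> j)} = {j\<in>I. \<omega> j \<in> A (\<omega> i)}"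
      by (auto simp: I_def A_def)
    thus ?thesis using I by (simp add: cnt_def indicator_def sum.If_cases Int_def)
  qed
  have ind: "(\<lambda>\<omega>. indicator (A (\<omega> i)) (\<omega> j) :: real) \<in> borel_measurable N" if "j \<in> I" for j
  proof -
    \<comment> \<open>The set \<open>A (\<omega> i)\<close> is itself random, so measurability has
      to come from the relation as a set of pairs.\<close>
    define S where "S = {z \<in> space (M \<Otimes>\<^sub>M M). Q (fst z) (snd z)}"
    have [measurable]: "S \<in> sets (M \<Otimes>\<^sub>M M)"
      using Q unfolding S_def pred_def by (simp add: case_prod_beta)
    have "(\<lambda>\<omega>. (\<omega> i, \<omega> j)) \<in> N \<rightarrow>\<^sub>M M \<Otimes>\<^sub>M M"
      using i that unfolding N_def by (auto simp: I_def)
    from measurable_compose[OF this, of "indicator S :: _ \<Rightarrow> real" borel]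
    have "(\<lambda>\<omega>. indicator S (\<omega> i, \<omega> j) :: real) \<in> borel_measurable N" by simp
    also have "?this \<longleftrightarrow> ?thesis"
      by (rule measurable_cong) (use i that in \<open>auto simp: S_def N_def space_PiM A_def I_def space_pair_measure indicator_def\<close>)
    finally show ?thesis .
  qed
  have cnt [measurable]: "cnt \<in> borel_measurable N"
    unfolding cnt_def by (intro borel_measurable_sum ind)
  have pi [measurable]: "(\<lambda>\<omega>. p (\<omega> i)) \<in> borel_measurable N"
    unfolding N_def using i by (intro measurable_compose[OF _ p] measurable_component_singleton) simp
  let ?B = "{\<omega> \<in> space N. 2 * real n * p (\<omega> i) + t \<le> cnt \<omega>}"
  have B_eq: "{\<omega> \<in> space N. 2 * real n * p (\<omega> i) + t \<le>
      real (card {j. j < n \<and> j \<noteq> i \<and> Q (\<omega> i) (\<omega> j)})} = ?B"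
    using card_eq by auto
  have B [measurable]: "?B \<in> sets N" by measurable
  \<comment> \<open>The exponential of the count, normalised by a bound on its conditional
    expectation given point \<open>i\<close>. The product form lets the integral factor over the
    other points.\<close>
  define f where "f = (\<lambda>\<omega>. ennreal (exp (- (2 * real n * p (\<omega> i)))) *
      (\<Prod>j\<in>I. ennreal (exp (indicator (A (\<omega> i)) (\<omega> j)))))"
  have f_eq: "f \<omega> = ennreal (exp (cnt \<omega> - 2 * real n * p (\<omega> i)))" for \<omega>
    unfolding f_def cnt_def
    by (subst prod_ennreal) (simp_all add: exp_sum I exp_diff exp_minus divide_inverse mult.commute flip: ennreal_mult'')
  have f [measurable]: "f \<in> borel_measurable N"
    unfolding f_eq by measurable
  \<comment> \<open>Point \<open>i\<close> is integrated last: inside, its position \<open>x\<close>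
    is fixed and the remaining coordinates are independent.\<close>
  have "(\<integral>\<^sup>+\<omega>. f \<omega> \<partial>N) = (\<integral>\<^sup>+x. (\<integral>\<^sup>+\<omega>. f (fun_upd \<omega> i x) \<partial>PiM I (\<lambda>_. M)) \<partial>M)"
    unfolding N_def I(3)[symmetric]
    by (rule P.product_nn_integral_insert_rev) (use I f in \<open>auto simp: N_def\<close>)
  also have "\<dots> \<le> (\<integral>\<^sup>+x. 1 \<partial>M)"
  proof (rule nn_integral_mono)
    fix x assume x: "x \<in> space M"
    note [measurable] = A[OF x]
    have "(\<integral>\<^sup>+\<omega>. f (fun_upd \<omega> i x) \<partial>PiM I (\<lambda>_. M)) = (\<integral>\<^sup>+\<omega>. ennreal (exp (- (2 * real n * p x))) *
        (\<Prod>j\<in>I. ennreal (exp (indicator (A x) (\<omega> j)))) \<partial>PiM I (\<lambda>_. M))"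
      unfolding f_def using I
      by (intro nn_integral_cong arg_cong2[where f = "(*)"] prod.cong) auto
    also have "\<dots> = ennreal (exp (- (2 * real n * p x))) *
        (\<Prod>j\<in>I. \<integral>\<^sup>+y. ennreal (exp (indicator (A x) y)) \<partial>M)"
      using I by (subst nn_integral_cmult)
        (simp_all add: P.product_nn_integral_prod[where f = "\<lambda>_ y. ennreal (exp (indicator (A x) y))"])
    also have "\<dots> \<le> ennreal (exp (- (2 * real n * p x))) * (\<Prod>j\<in>I. ennreal (exp (2 * p x)))"
    proof -
      have "emeasure M (A x) \<le> ennreal (p x)" using le[OF x] by (simp add: A_def)
      thus ?thesis
        using p_nonneg by (intro mult_left_mono prod_mono_ennreal nn_integral_exp_indicator_le) auto
    qed
    also have "\<dots> = ennreal (exp (2 * p x * (real (card I) - real n)))"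
      by (simp add: ennreal_power exp_of_nat_mult[symmetric] algebra_simps flip: ennreal_mult exp_add)
    \<comment> \<open>There are at most \<open>n\<close> factors, so the normalisation outweighs
      them.\<close>
    also have "\<dots> \<le> ennreal 1"
      using cardI p_nonneg[of x] by (intro ennreal_leI) (simp add: mult_nonneg_nonpos)
    finally show "(\<integral>\<^sup>+\<omega>. f (fun_upd \<omega> i x) \<partial>PiM I (\<lambda>_. M)) \<le> 1" by simp
  qed
  also have "\<dots> = 1" by (simp add: emeasure_space_1)
  finally have int: "(\<integral>\<^sup>+\<omega>. f \<omega> \<partial>N) \<le> 1" .
  \<comment> \<open>On \<open>?B\<close> the function \<open>f\<close> is at least
    \<open>exp t\<close>, so Markov's inequality applies.\<close>
  have "emeasure N ?B \<le> emeasure N {\<omega> \<in> space N. 1 \<le> ennreal (exp (- t)) * f \<omega>}"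
    unfolding f_eq by (intro emeasure_mono) (auto simp flip: ennreal_mult exp_add)
  also have "\<dots> \<le> ennreal (exp (- t)) * (\<integral>\<^sup>+\<omega>. f \<omega> * indicator (space N) \<omega> \<partial>N)"
    by (rule nn_integral_Markov_inequality) auto
  also have "(\<integral>\<^sup>+\<omega>. f \<omega> * indicator (space N) \<omega> \<partial>N) = (\<integral>\<^sup>+\<omega>. f \<omega> \<partial>N)"
    by (intro nn_integral_cong) auto
  also have "ennreal (exp (- t)) * \<dots> \<le> ennreal (exp (- t)) * 1"
    using int by (intro mult_left_mono) auto
  finally have "measure N ?B \<le> exp (- t)" by (simp add: N.emeasure_eq_measure)
  with B show "measure N {\<omega> \<in> space N. 2 * real n * p (\<omega> i) + t \<le>
      real (card {j. j < n \<and> j \<noteq> i \<and> Q (\<omega> i) (\<omega> j)})} \<le> exp (- t)"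
    and "{\<omega> \<in> space N. 2 * real n * p (\<omega> i) + t \<le>
      real (card {j. j < n \<and> j \<noteq> i \<and> Q (\<omega> i) (\<omega> j)})} \<in> sets N"
    unfolding B_eq by auto
qed

section \<open>Reduction to sectors that start at a vertex\<close>

lemma in_sector_iff:
  "q \<in> sector R a w \<longleftrightarrow> 0 \<le> fst q \<and> fst q \<le> R \<and> snd q \<in> sector_angles a w"
  by (auto simp: sector_def sector_angles_def split: prod.splits)

text \<open>
  Rotating a sector until it starts at its first vertex only adds vertices. This makes the
  quantifier over all sectors finite, both for measurability and for the union bound.
\<close>

lemma sector_subset_sector_at_vertex:
  fixes \<omega> :: "nat \<Rightarrow> polar"
  assumes "finite J" "i0 \<in> J" "\<omega> i0 \<in> sector R a w"
  shows "\<exists>i\<in>J. \<forall>j\<in>J. \<omega> j \<in> sector R a w \<longrightarrow> \<omega> j \<in> sector R (snd (\<omega> i)) w"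
proof -
  define S where "S = {j\<in>J. \<omega> j \<in> sector R a w}"
  have S: "finite S" "S \<noteq> {}" using assms by (auto simp: S_def)
  have "\<forall>j\<in>S. \<exists>k::int. a \<le> snd (\<omega> j) + 2 * pi * of_int k \<and> snd (\<omega> j) + 2 * pi * of_int k \<le> a + w"
    by (auto simp: S_def in_sector_iff sector_angles_def)
  then obtain k :: "nat \<Rightarrow> int" where k: "\<And>j. j \<in> S \<Longrightarrow>
      a \<le> snd (\<omega> j) + 2 * pi * of_int (k j) \<and> snd (\<omega> j) + 2 * pi * of_int (k j) \<le> a + w"
    by metis
  \<comment> \<open>Lifts of the angles into the window from \<open>a\<close> to
    \<open>a + w\<close> on the real line; the vertex with the least lift is the first of the
    sector.\<close>
  define u where "u = (\<lambda>j. snd (\<omega> j) + 2 * pi * of_int (k j))"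
  obtain i where i: "i \<in> S" "\<And>j. j \<in> S \<Longrightarrow> u i \<le> u j"
    using ex_min_if_finite[of "u ` S"] S by (metis finite_imageI image_iff image_is_empty not_le)
  have "\<omega> j \<in> sector R (snd (\<omega> i)) w" if "j \<in> S" for j
  proof -
    have "u j - u i + snd (\<omega> i) = snd (\<omega> j) + 2 * pi * of_int (k j - k i)"
      by (simp add: u_def algebra_simps)
    moreover have "0 \<le> u j - u i" "u j - u i \<le> w"
      using i(2)[OF that] k[OF that] k[OF i(1)] by (auto simp: u_def)
    ultimately have "snd (\<omega> i) \<le> snd (\<omega> j) + 2 * pi * of_int (k j - k i)"
      "snd (\<omega> j) + 2 * pi * of_int (k j - k i) \<le> snd (\<omega> i) + w"
      by linarith+
    hence "\<exists>k::int. snd (\<omega> i) \<le> snd (\<omega> j) + 2 * pi * of_int k \<and>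
        snd (\<omega> j) + 2 * pi * of_int k \<le> snd (\<omega> i) + w"
      by blast
    with that show ?thesis by (simp add: S_def in_sector_iff sector_angles_def)
  qed
  with i(1) show ?thesis by (auto simp: S_def)
qed

text \<open>A sector containing a vertex is dominated by one that starts at a vertex; an empty
  sector has sum zero, where \<open>0 \<le> c\<close> enters.\<close>

lemma all_sector_degree_sums_le_iff:
  assumes "0 \<le> c"
  shows "(\<forall>a. real (sector_degree_sum C n \<omega> a w) \<le> c) \<longleftrightarrow>
    (\<forall>i<n. real (sector_degree_sum C n \<omega> (snd (\<omega> i)) w) \<le> c)"
proof (intro iffI allI)
  fix a assume *: "\<forall>i<n. real (sector_degree_sum C n \<omega> (snd (\<omega> i)) w) \<le> c"
  show "real (sector_degree_sum C n \<omega> a w) \<le> c"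
  proof (cases "\<exists>i<n. \<omega> i \<in> sector (hrg_radius C n) a w")
    case True
    then obtain i where i: "i < n" and sub: "\<And>j. j < n \<Longrightarrow> \<omega> j \<in> sector (hrg_radius C n) a w \<Longrightarrow>
        \<omega> j \<in> sector (hrg_radius C n) (snd (\<omega> i)) w"
      using sector_subset_sector_at_vertex[of "{..<n}" _ \<omega> "hrg_radius C n" a w]
      by (metis lessThan_iff finite_lessThan)
    have "sector_degree_sum C n \<omega> a w \<le> sector_degree_sum C n \<omega> (snd (\<omega> i)) w"
      unfolding sector_degree_sum_def using sub by (intro sum_mono2) auto
    with * i show ?thesis by (meson of_nat_mono order_trans)
  next
    case False
    hence "sector_degree_sum C n \<omega> a w = 0" by (auto simp: sector_degree_sum_def)
    with assms show ?thesis by simp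
  qed
qed auto

section \<open>Degree sums through level sets\<close>

lemma sum_eq_sum_card_levels:
  fixes f :: "'a \<Rightarrow> nat"
  assumes "finite S" "\<And>v. v \<in> S \<Longrightarrow> f v \<le> D"
  shows "(\<Sum>v\<in>S. f v) = (\<Sum>d=1..D. card {v\<in>S. d \<le> f v})"
proof -
  \<comment> \<open>Double counting of the pairs \<open>(v, d)\<close> with
    \<open>1 \<le> d \<le> f v\<close>.\<close>
  have "(\<Sum>v\<in>S. f v) = (\<Sum>v\<in>S. card {d\<in>{1..D}. d \<le> f v})"
  proof (rule sum.cong)
    fix v assume "v \<in> S"
    hence "{d\<in>{1..D}. d \<le> f v} = {1..f v}" using assms(2)[of v] by auto
    thus "f v = card {d\<in>{1..D}. d \<le> f v}" by simp
  qed simp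
  also have "\<dots> = (\<Sum>d=1..D. card {v\<in>S. d \<le> f v})"
    using assms by (intro sum_multicount_gen[symmetric]) auto
  finally show ?thesis .
qed

lemma hrg_degree_le_max: "i < n \<Longrightarrow> hrg_degree C n \<omega> i \<le> hrg_max_degree C n \<omega>"
  by (simp add: hrg_max_degree_def)

lemma hrg_max_degree_le:
  assumes "0 < n"
  shows "hrg_max_degree C n \<omega> \<le> n"
proof -
  have "card {j. j < n \<and> Q j} \<le> n" for Q
    using card_mono[of "{..<n}" "{j. j < n \<and> Q j}"] by auto
  hence "hrg_degree C n \<omega> i \<le> n" for i
    unfolding hrg_degree_def by blast
  moreover have "{..<n} \<noteq> {}" using assms by (simp add: lessThan_empty_iff)
  ultimately show ?thesis unfolding hrg_max_degree_def by (intro Max.boundedI) auto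
qed

text \<open>The counts omit vertex \<open>i\<close> because the Chernoff bound conditions on its
  position. Putting it back costs one per level, hence \<open>B + 1\<close>; the terms
  \<open>A / d\<close> add up to a harmonic sum.\<close>

lemma sector_degree_sum_le_of_counts:
  assumes i: "i < n" and A: "0 \<le> A"
    and count: "\<And>d. 1 \<le> d \<Longrightarrow> d \<le> n \<Longrightarrow>
      real (card {j. j < n \<and> j \<noteq> i \<and> \<omega> j \<in> sector (hrg_radius C n) a w \<and> d \<le> hrg_degree C n \<omega> j})
        \<le> A / real d + B"
  shows "real (sector_degree_sum C n \<omega> a w)
    \<le> A * (1 + ln (real n)) + (B + 1) * real (hrg_max_degree C n \<omega>)"
proof -
  define D where "D = hrg_max_degree C n \<omega>"
  define S where "S = {j. j < n \<and> \<omega> j \<in> sector (hrg_radius C n) a w}"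
  have D: "D \<le> n" using i hrg_max_degree_le[of n] by (simp add: D_def)
  have "real (sector_degree_sum C n \<omega> a w) = (\<Sum>d=1..D. real (card {j\<in>S. d \<le> hrg_degree C n \<omega> j}))"
    unfolding sector_degree_sum_def S_def[symmetric]
    by (subst sum_eq_sum_card_levels[of _ _ D]) (auto simp: S_def D_def hrg_degree_le_max)
  also have "\<dots> \<le> (\<Sum>d=1..D. A * inverse (real d) + (B + 1))"
  proof (rule sum_mono)
    fix d assume d: "d \<in> {1..D}"
    let ?T = "{j. j < n \<and> j \<noteq> i \<and> \<omega> j \<in> sector (hrg_radius C n) a w \<and> d \<le> hrg_degree C n \<omega> j}"
    have "card {j\<in>S. d \<le> hrg_degree C n \<omega> j} \<le> card (insert i ?T)"
      by (rule card_mono) (auto simp: S_def)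
    also have "\<dots> = card ?T + 1" by simp
    finally show "real (card {j\<in>S. d \<le> hrg_degree C n \<omega> j}) \<le> A * inverse (real d) + (B + 1)"
      using count[of d] d D by (simp add: divide_inverse)
  qed
  also have "\<dots> = A * harm D + (B + 1) * real D"
    by (simp add: sum.distrib harm_def sum_distrib_left)
  also have "harm D \<le> (harm n :: real)" using D by (rule harm_mono)
  \<comment> \<open>\<open>harm n - ln n\<close> decreases from its value 1 at
    \<open>n = 1\<close>.\<close>
  also have "harm n \<le> 1 + ln (real n)"
    using euler_mascheroni_sequence_decreasing[of 1 n] i by (simp add: harm_expand)
  finally show ?thesis using A by (simp add: D_def mult_left_mono)
qed

section \<open>Measurability of the events\<close>

lemma card_less_eq_sum_if:
  fixes P :: "nat \<Rightarrow> bool"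
  shows "real (card {j. j < n \<and> P j}) = (\<Sum>j<n. if P j then 1 else 0)"
  using sum.inter_filter[OF finite_lessThan, where g = "\<lambda>_. 1 :: real" and P = P] by simp

lemma sets_point_measure [measurable_cong, simp]:
  "sets (point_measure \<alpha> R) = sets (borel \<Otimes>\<^sub>M borel)"
  by (intro sets_pair_measure_cong) auto

lemma space_point_measure [simp]: "space (point_measure \<alpha> R) = UNIV"
  by (simp add: space_pair_measure radial_measure_def angular_measure_def)

lemma pred_in_sector [measurable]:
  assumes [measurable]: "f \<in> M \<rightarrow>\<^sub>M borel \<Otimes>\<^sub>M borel" "g \<in> M \<rightarrow>\<^sub>M borel \<Otimes>\<^sub>M borel"
  shows "Measurable.pred M (\<lambda>x. f x \<in> sector R (snd (g x)) w)"
  unfolding in_sector_iff sector_angles_def mem_Collect_eq by measurable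

text \<open>Measurability must be shown because lower bounds on \<open>measure\<close> by
  monotonicity need it. The uncountable quantifier over \<open>a\<close> is replaced by one over
  vertices, and the rest is built from finitely many measurable functions.\<close>

lemma sets_sector_degree_sums_le:
  fixes \<alpha> C w c1 c2 :: real and n :: nat
  assumes n: "0 < n" and c: "0 \<le> c1" "0 \<le> c2"
  defines "N \<equiv> hrg_measure \<alpha> C n"
  shows "{\<omega> \<in> space N. \<forall>a. real (sector_degree_sum C n \<omega> a w) \<le>
    c1 + c2 * real (hrg_max_degree C n \<omega>)} \<in> sets N"
proof -
  let ?R = "hrg_radius C n"
  have comp: "(\<lambda>\<omega>. \<omega> i) \<in> N \<rightarrow>\<^sub>M borel \<Otimes>\<^sub>M borel" if "i < n" for i
  proof -
    have "(\<lambda>\<omega>. \<omega> i) \<in> N \<rightarrow>\<^sub>M point_measure \<alpha> ?R"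
      unfolding N_def hrg_measure_def using that by (intro measurable_component_singleton) auto
    thus ?thesis
      using measurable_cong_sets[OF refl sets_point_measure] by blast
  qed
  have deg: "(\<lambda>\<omega>. real (hrg_degree C n \<omega> i)) \<in> borel_measurable N" if i: "i < n" for i
    unfolding hrg_degree_def card_less_eq_sum_if hrg_adj_def
  proof (intro borel_measurable_sum measurable_If measurable_const)
    fix j assume "j \<in> {..<n}"
    hence [measurable]: "(\<lambda>\<omega>. hyp_dist (\<omega> i) (\<omega> j)) \<in> borel_measurable N"
      using i by (intro hyp_dist_measurable comp) auto
    show "{\<omega> \<in> space N. i \<noteq> j \<and> hyp_dist (\<omega> i) (\<omega> j) < ?R} \<in> sets N" by measurable
  qed simp_all
  have sds: "(\<lambda>\<omega>. real (sector_degree_sum C n \<omega> (snd (\<omega> i)) w)) \<in> borel_measurable N"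
    if i: "i < n" for i
  proof -
    have eq: "real (sector_degree_sum C n \<omega> a w) =
        (\<Sum>v<n. if \<omega> v \<in> sector ?R a w then real (hrg_degree C n \<omega> v) else 0)" for \<omega> a
      using sum.inter_filter[OF finite_lessThan, where g = "\<lambda>v. real (hrg_degree C n \<omega> v)"
          and P = "\<lambda>v. \<omega> v \<in> sector ?R a w"]
      by (simp add: sector_degree_sum_def)
    show ?thesis
      unfolding eq
    proof (intro borel_measurable_sum measurable_If measurable_const deg)
      fix j assume "j \<in> {..<n}"
      thus "{\<omega> \<in> space N. \<omega> j \<in> sector ?R (snd (\<omega> i)) w} \<in> sets N"
        using pred_in_sector[OF comp comp[OF i]] unfolding pred_def by auto
    qed simp_all
  qed
  \<comment> \<open>As \<open>c2\<close> is nonnegative, the bound with the maximum degree holds iff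
    it holds with the degree of some vertex.\<close>
  have iff: "(\<forall>a. real (sector_degree_sum C n \<omega> a w) \<le> c1 + c2 * real (hrg_max_degree C n \<omega>)) \<longleftrightarrow>
      (\<forall>i<n. \<exists>k<n. real (sector_degree_sum C n \<omega> (snd (\<omega> i)) w) \<le> c1 + c2 * real (hrg_degree C n \<omega> k))"
    for \<omega>
  proof -
    have "hrg_max_degree C n \<omega> \<in> hrg_degree C n \<omega> ` {..<n}"
      unfolding hrg_max_degree_def using n by (intro Max_in) auto
    then obtain m where m: "m < n" "hrg_max_degree C n \<omega> = hrg_degree C n \<omega> m" by auto
    have le: "c1 + c2 * real (hrg_degree C n \<omega> k) \<le> c1 + c2 * real (hrg_max_degree C n \<omega>)" if "k < n" for k
      using hrg_degree_le_max[OF that] c by (intro add_left_mono mult_left_mono) auto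
    have "(\<exists>k<n. x \<le> c1 + c2 * real (hrg_degree C n \<omega> k)) \<longleftrightarrow>
        x \<le> c1 + c2 * real (hrg_max_degree C n \<omega>)" for x
    proof
      assume "\<exists>k<n. x \<le> c1 + c2 * real (hrg_degree C n \<omega> k)"
      then obtain k where "k < n" "x \<le> c1 + c2 * real (hrg_degree C n \<omega> k)" by blast
      with le[of k] show "x \<le> c1 + c2 * real (hrg_max_degree C n \<omega>)" by linarith
    next
      assume "x \<le> c1 + c2 * real (hrg_max_degree C n \<omega>)"
      with m show "\<exists>k<n. x \<le> c1 + c2 * real (hrg_degree C n \<omega> k)" by auto
    qed
    thus ?thesis
      using c by (subst all_sector_degree_sums_le_iff) auto
  qed
  have "{\<omega> \<in> space N. \<forall>i<n. \<exists>k<n.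
      real (sector_degree_sum C n \<omega> (snd (\<omega> i)) w) \<le> c1 + c2 * real (hrg_degree C n \<omega> k)} \<in> sets N"
  proof -
    have "{\<omega> \<in> space N. \<forall>i\<in>{..<n}. \<exists>k\<in>{..<n}.
      real (sector_degree_sum C n \<omega> (snd (\<omega> i)) w) \<le> c1 + c2 * real (hrg_degree C n \<omega> k)} \<in> sets N"
      by (intro sets.sets_Collect_finite_All sets.sets_Collect_finite_Ex borel_measurable_le
          sds borel_measurable_add borel_measurable_times deg) auto
    thus ?thesis by (simp only: Ball_def Bex_def lessThan_iff)
  qed
  thus ?thesis by (simp only: iff)
qed

section \<open>The probability bound for a fixed number of vertices\<close>

lemma (in finite_measure) measure_UN_le_card:
  assumes "finite I" "\<And>i. i \<in> I \<Longrightarrow> A i \<in> sets M" "\<And>i. i \<in> I \<Longrightarrow> measure M (A i) \<le> c"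
  shows "measure M (\<Union>i\<in>I. A i) \<le> real (card I) * c"
proof -
  have "measure M (\<Union>i\<in>I. A i) \<le> (\<Sum>i\<in>I. measure M (A i))"
    using assms by (intro finite_measure_subadditive_finite) auto
  also have "\<dots> \<le> real (card I) * c"
    using assms sum_bounded_above[of I "\<lambda>i. measure M (A i)" c] by simp
  finally show ?thesis .
qed

text \<open>Two kinds of bad events are excluded by a union bound: a vertex with too large a degree
  for its radius, and a sector starting at a vertex with too many points close enough to the origin
  to reach degree \<open>d\<close>. \<open>L * exp ((R - r) / 2)\<close> is the resulting degree
  bound at radius \<open>r\<close>.\<close>

lemma prob_sector_degree_sums_le:
  fixes \<alpha> C w :: real and n :: nat
  assumes \<alpha>: "1 / 2 < \<alpha>" "\<alpha> < 1" and w: "0 \<le> w" and n: "0 < n"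
  defines "R \<equiv> hrg_radius C n" and "N \<equiv> hrg_measure \<alpha> C n"
  assumes R: "2 \<le> R"
  defines "L \<equiv> 96 * real n * R * exp (- R / 2) + 2 * ln (real n)"
  shows "1 - 2 / real n \<le> measure N {\<omega> \<in> space N. \<forall>a. real (sector_degree_sum C n \<omega> a w) \<le>
    8 * real n * w * L * R * (1 + ln (real n)) + (3 * ln (real n) + 1) * real (hrg_max_degree C n \<omega>)}"
    (is "_ \<le> measure N ?G")
proof -
  interpret M: prob_space "point_measure \<alpha> R"
    using \<alpha> R by (intro prob_space_pair prob_space_radial prob_space_angular) auto
  have N_eq: "N = PiM {..<n} (\<lambda>_. point_measure \<alpha> R)"
    by (simp add: N_def hrg_measure_def R_def)
  interpret N: prob_space N
    unfolding N_eq by (intro prob_space_PiM) unfold_locales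
  have ln_nonneg: "0 \<le> ln (real n)" using n by simp
  have L: "0 \<le> L" unfolding L_def using R ln_nonneg by simp

  have const: "(\<lambda>_. q) \<in> borel \<Otimes>\<^sub>M borel \<rightarrow>\<^sub>M borel \<Otimes>\<^sub>M borel" for q :: polar
    by (simp add: space_pair_measure)

  define disk where "disk = (\<lambda>q::polar. 0 \<le> fst q \<and> fst q \<le> R \<and> 0 \<le> snd q \<and> snd q < 2 * pi)"
  \<comment> \<open>Requiring \<open>disk q\<close> makes the bound hold for every \<open>q\<close>:
    the adjacency estimate covers the disk, and outside it the relation is empty.\<close>
  define Q1 where "Q1 = (\<lambda>q p. disk q \<and> hyp_dist q p < R)"
  \<comment> \<open>48 = 4 * 12: the factor 4 of the slice integration times the constant 12 of the
    adjacency estimate.\<close>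
  define p1 where "p1 = (\<lambda>q::polar. 48 * R * exp (- fst q / 2))"
  define E1 where "E1 = (\<lambda>i. {\<omega> \<in> space N. 2 * real n * p1 (\<omega> i) + 2 * ln (real n) \<le>
    real (card {j. j < n \<and> j \<noteq> i \<and> Q1 (\<omega> i) (\<omega> j)})})"
  have E1: "E1 i \<in> sets N \<and> measure N (E1 i) \<le> exp (- (2 * ln (real n)))" if "i < n" for i
  proof -
    have Q: "Measurable.pred (point_measure \<alpha> R \<Otimes>\<^sub>M point_measure \<alpha> R) (\<lambda>(q, p). Q1 q p)"
      unfolding Q1_def disk_def case_prod_beta by measurable
    have p: "p1 \<in> borel_measurable (point_measure \<alpha> R)" unfolding p1_def by measurable
    have p0: "0 \<le> p1 q" for q using R by (simp add: p1_def)
    have le: "emeasure (point_measure \<alpha> R) {y \<in> space (point_measure \<alpha> R). Q1 q y} \<le> ennreal (p1 q)" for q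
    proof (cases "disk q")
      case True
      have [measurable]: "{y. hyp_dist q y < R} \<in> sets (borel \<Otimes>\<^sub>M borel)"
      proof -
        have "{y \<in> space (borel \<Otimes>\<^sub>M borel). hyp_dist q y < R} \<in> sets (borel \<Otimes>\<^sub>M borel)"
          by (intro borel_measurable_less hyp_dist_measurable const measurable_ident_sets refl measurable_const) simp_all
        thus ?thesis by (simp add: space_pair_measure)
      qed
      have "emeasure (point_measure \<alpha> R) {y. hyp_dist q y < R} \<le> ennreal (4 * (12 * exp (- fst q / 2)) * R)"
      proof (rule emeasure_point_measure_le[OF \<alpha> R])
        fix s assume s: "0 \<le> s" "s \<le> R"
        have "emeasure angular_measure {v. hyp_dist (fst q, snd q) (s, v) < R}
            \<le> ennreal (12 * exp ((R - fst q - s) / 2))"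
          using True s by (intro emeasure_angular_adjacent_le) (auto simp: disk_def)
        also have "exp ((R - fst q - s) / 2) = exp (- fst q / 2) * exp ((R - s) / 2)"
          unfolding exp_add[symmetric] by (simp add: field_simps)
        finally show "emeasure angular_measure (Pair s -` {y. hyp_dist q y < R})
            \<le> ennreal (12 * exp (- fst q / 2) * exp ((R - s) / 2))"
          by (simp add: vimage_def mult.assoc)
      qed (simp, measurable)
      thus ?thesis using True by (simp add: Q1_def p1_def mult_ac)
    qed (simp add: Q1_def)
    show ?thesis
      unfolding E1_def N_eq by (intro conjI M.prob_count_related_ge[OF that Q p p0 le])
  qed

  \<comment> \<open>A degree depends on all points, which would destroy independence. The condition
    \<open>d \<le> degree\<close> is therefore replaced by the condition on the radius that it
    forces once no \<open>E1\<close> occurs.\<close>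
  define Q2 where "Q2 = (\<lambda>(d::nat) (q::polar) (p::polar). p \<in> sector R (snd q) w \<and> real d \<le> L * exp ((R - fst p) / 2))"
  define p2 where "p2 = (\<lambda>d::nat. 4 * (w * L / real d) * R)"
  \<comment> \<open>The deviation is \<open>3 * ln n\<close> instead of \<open>2 * ln n\<close>
    because there are \<open>n ^ 2\<close> pairs \<open>(i, d)\<close>.\<close>
  define E2 where "E2 = (\<lambda>(i, d). {\<omega> \<in> space N. 2 * real n * p2 d + 3 * ln (real n) \<le>
    real (card {j. j < n \<and> j \<noteq> i \<and> Q2 d (\<omega> i) (\<omega> j)})})"
  have E2: "E2 (i, d) \<in> sets N \<and> measure N (E2 (i, d)) \<le> exp (- (3 * ln (real n)))"
    if "i < n" "1 \<le> d" for i d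
  proof -
    have Q: "Measurable.pred (point_measure \<alpha> R \<Otimes>\<^sub>M point_measure \<alpha> R) (\<lambda>(q, p). Q2 d q p)"
      unfolding Q2_def case_prod_beta by measurable
    have p0: "0 \<le> p2 d" using R w L by (simp add: p2_def)
    have le: "emeasure (point_measure \<alpha> R) {y \<in> space (point_measure \<alpha> R). Q2 d q y} \<le> ennreal (p2 d)" for q
    proof -
      have meas [measurable]: "{y. Q2 d q y} \<in> sets (borel \<Otimes>\<^sub>M borel)"
      proof -
        have [measurable]: "Measurable.pred (borel \<Otimes>\<^sub>M borel) (\<lambda>y. y \<in> sector R (snd q) w)"
          by (intro pred_in_sector const measurable_ident_sets refl)
        have "{y \<in> space (borel \<Otimes>\<^sub>M borel). Q2 d q y} \<in> sets (borel \<Otimes>\<^sub>M borel)"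
          unfolding Q2_def by measurable
        thus ?thesis by (simp add: space_pair_measure)
      qed
      have "emeasure (point_measure \<alpha> R) {y. Q2 d q y} \<le> ennreal (4 * (w * L / real d) * R)"
      proof (rule emeasure_point_measure_le[OF \<alpha> R])
        fix s assume s: "0 \<le> s" "s \<le> R"
        show "emeasure angular_measure (Pair s -` {y. Q2 d q y})
            \<le> ennreal (w * L / real d * exp ((R - s) / 2))"
        proof (cases "real d \<le> L * exp ((R - s) / 2)")
          case True
          have "emeasure angular_measure (Pair s -` {y. Q2 d q y})
              \<le> emeasure angular_measure (sector_angles (snd q) w)"
            by (intro emeasure_mono) (auto simp: Q2_def in_sector_iff)
          also have "\<dots> \<le> ennreal (w / pi)" by (rule emeasure_angular_sector_angles_le[OF w])
          also have "\<dots> \<le> ennreal (w * L / real d * exp ((R - s) / 2))"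
          proof (rule ennreal_leI)
            have "w / pi \<le> w / 1" using w pi_gt3 by (intro divide_left_mono) auto
            \<comment> \<open>The slice is nonempty only if this ratio is at least one. Multiplying
              by it supplies the exponential that the integration lemma cancels, and the gain
              \<open>1 / d\<close>.\<close>
            also have "\<dots> \<le> w * (L * exp ((R - s) / 2) / real d)"
            proof -
              have "1 \<le> L * exp ((R - s) / 2) / real d" using True that by simp
              from mult_left_mono[OF this w] show ?thesis by simp
            qed
            finally show "w / pi \<le> w * L / real d * exp ((R - s) / 2)" by (simp add: mult_ac)
          qed
          finally show ?thesis .
        next
          case False
          hence "Pair s -` {y. Q2 d q y} = {}" by (auto simp: Q2_def)
          thus ?thesis by simp
        qed
      qed (use w L in simp, measurable)
      thus ?thesis by (simp add: p2_def)
    qed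
    show ?thesis
      unfolding E2_def N_eq prod.case
      by (intro conjI M.prob_count_related_ge[OF that(1) Q measurable_const p0 le]) simp_all
  qed

  define B where "B = (\<Union>i\<in>{..<n}. E1 i) \<union> (\<Union>z\<in>{..<n} \<times> {1..n}. E2 z)"
  have B_sets: "B \<in> sets N"
    unfolding B_def using E1 E2 by (intro sets.Un sets.finite_UN) auto
  have "measure N B \<le> measure N (\<Union>i\<in>{..<n}. E1 i) + measure N (\<Union>z\<in>{..<n} \<times> {1..n}. E2 z)"
    unfolding B_def using E1 E2 by (intro measure_Un_le sets.finite_UN) auto
  also have "\<dots> \<le> real (card {..<n}) * exp (- (2 * ln (real n)))
      + real (card ({..<n} \<times> {1..n})) * exp (- (3 * ln (real n)))"
    using E1 E2 by (intro add_mono N.measure_UN_le_card) auto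
  \<comment> \<open>Each kind of event contributes \<open>1 / n\<close>, as
    \<open>n * n ^ -2\<close> and \<open>n ^ 2 * n ^ -3\<close>.\<close>
  also have "\<dots> = 2 / real n"
  proof -
    have "exp (- (2 * ln (real n))) = 1 / real n ^ 2" "exp (- (3 * ln (real n))) = 1 / real n ^ 3"
      using n exp_of_nat_mult[of 2 "ln (real n)"] exp_of_nat_mult[of 3 "ln (real n)"]
      by (simp_all add: exp_minus divide_inverse)
    thus ?thesis using n by (simp add: power2_eq_square power3_eq_cube)
  qed
  finally have B_le: "measure N B \<le> 2 / real n" .

  have good: "\<omega> \<in> ?G" if \<omega>: "\<omega> \<in> space N" "\<omega> \<notin> B" for \<omega>
  proof -
    have deg_le: "real (hrg_degree C n \<omega> j) \<le> L * exp ((R - fst (\<omega> j)) / 2)"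
      if j: "j < n" "disk (\<omega> j)" for j
    proof -
      have "real (hrg_degree C n \<omega> j) = real (card {k. k < n \<and> k \<noteq> j \<and> Q1 (\<omega> j) (\<omega> k)})"
        using j by (simp add: hrg_degree_def hrg_adj_def Q1_def R_def conj_ac eq_commute[of j])
      also have "\<dots> \<le> 2 * real n * p1 (\<omega> j) + 2 * ln (real n)"
      proof -
        have "\<omega> \<notin> E1 j" using \<omega>(2) j unfolding B_def by blast
        thus ?thesis using \<omega>(1) unfolding E1_def by auto
      qed
      also have "2 * real n * p1 (\<omega> j) = 96 * real n * R * exp (- R / 2) * exp ((R - fst (\<omega> j)) / 2)"
        by (simp add: p1_def mult.assoc diff_divide_distrib flip: exp_add)
      \<comment> \<open>Inside the disk the exponential is at least one, so the additive deviation
        can be absorbed into \<open>L\<close>.\<close>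
      also have "2 * ln (real n) \<le> 2 * ln (real n) * exp ((R - fst (\<omega> j)) / 2)"
      proof -
        have "1 \<le> exp ((R - fst (\<omega> j)) / 2)" using j by (simp add: disk_def)
        from mult_left_mono[OF this, of "2 * ln (real n)"] ln_nonneg show ?thesis by simp
      qed
      finally show ?thesis by (simp add: L_def distrib_right)
    qed
    have "real (sector_degree_sum C n \<omega> (snd (\<omega> i)) w) \<le>
        8 * real n * w * L * R * (1 + ln (real n)) + (3 * ln (real n) + 1) * real (hrg_max_degree C n \<omega>)"
      if i: "i < n" for i
    proof (rule sector_degree_sum_le_of_counts[OF i])
      fix d :: nat assume d: "1 \<le> d" "d \<le> n"
      have "real (card {j. j < n \<and> j \<noteq> i \<and> \<omega> j \<in> sector (hrg_radius C n) (snd (\<omega> i)) w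
          \<and> d \<le> hrg_degree C n \<omega> j}) \<le> real (card {j. j < n \<and> j \<noteq> i \<and> Q2 d (\<omega> i) (\<omega> j)})"
      proof (intro of_nat_mono card_mono subsetI)
        fix j assume "j \<in> {j. j < n \<and> j \<noteq> i \<and> \<omega> j \<in> sector (hrg_radius C n) (snd (\<omega> i)) w
          \<and> d \<le> hrg_degree C n \<omega> j}"
        hence j: "j < n" "j \<noteq> i" "\<omega> j \<in> sector R (snd (\<omega> i)) w" "real d \<le> real (hrg_degree C n \<omega> j)"
          by (auto simp: R_def)
        have "disk (\<omega> j)" using j(3) by (auto simp: disk_def in_sector_iff sector_angles_def)
        with deg_le[OF j(1)] j show "j \<in> {j. j < n \<and> j \<noteq> i \<and> Q2 d (\<omega> i) (\<omega> j)}"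
          by (auto simp: Q2_def)
      qed simp
      also have "\<dots> \<le> 2 * real n * p2 d + 3 * ln (real n)"
      proof -
        have "(i, d) \<in> {..<n} \<times> {1..n}" using i d by simp
        hence "\<omega> \<notin> E2 (i, d)" using \<omega>(2) unfolding B_def by blast
        thus ?thesis using \<omega>(1) unfolding E2_def by auto
      qed
      also have "2 * real n * p2 d = 8 * real n * w * L * R / real d" by (simp add: p2_def)
      finally show "real (card {j. j < n \<and> j \<noteq> i \<and> \<omega> j \<in> sector (hrg_radius C n) (snd (\<omega> i)) w
          \<and> d \<le> hrg_degree C n \<omega> j}) \<le> 8 * real n * w * L * R / real d + 3 * ln (real n)" .
    qed (use w L R in simp)
    moreover have "0 \<le> 8 * real n * w * L * R * (1 + ln (real n))
        + (3 * ln (real n) + 1) * real (hrg_max_degree C n \<omega>)"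
      using w L R ln_nonneg by (intro add_nonneg_nonneg mult_nonneg_nonneg) auto
    ultimately have "\<forall>a. real (sector_degree_sum C n \<omega> a w) \<le> 8 * real n * w * L * R * (1 + ln (real n))
        + (3 * ln (real n) + 1) * real (hrg_max_degree C n \<omega>)"
      by (intro all_sector_degree_sums_le_iff[THEN iffD2] allI impI)
    with \<omega>(1) show ?thesis by blast
  qed
  have G_sets: "?G \<in> sets N"
    unfolding N_def using w L R ln_nonneg n
    by (intro sets_sector_degree_sums_le mult_nonneg_nonneg add_nonneg_nonneg) simp_all
  have "1 - 2 / real n \<le> 1 - measure N B" using B_le by simp
  also have "\<dots> = measure N (space N - B)" using N.prob_compl[OF B_sets] by simp
  also have "\<dots> \<le> measure N ?G" using good by (intro N.finite_measure_mono[OF _ G_sets]) blast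
  finally show ?thesis .
qed

section \<open>From fixed \<open>n\<close> to the asymptotic statement\<close>

theorem theorem8:
  fixes \<alpha> C :: real and \<phi> :: "nat \<Rightarrow> real"
  assumes "1 / 2 < \<alpha>" and "\<alpha> < 1"
    and "\<And>n. 0 \<le> \<phi> n"
    and "\<phi> \<in> \<Omega>(\<lambda>n. real n powr (1 - 1 / \<alpha>) * ln (real n))"
  shows "whp_soft_O (hrg_measure \<alpha> C) UNIV
    (\<lambda>n a \<omega>. real (sector_degree_sum C n \<omega> a (\<phi> n)))
    (\<lambda>n \<omega>. \<phi> n * real n + real (hrg_max_degree C n \<omega>))"
proof -
  define c where "c = 2 + \<bar>C\<bar>"
  \<comment> \<open>The first summand bounds \<open>8 * L * R * (1 + ln n)\<close> divided by
    \<open>ln n ^ 3\<close>, using \<open>R \<le> c * ln n\<close> and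
    \<open>1 + ln n \<le> 2 * ln n\<close>; the 4 covers
    \<open>3 * ln n + 1 \<le> 4 * ln n\<close>.\<close>
  define K where "K = 16 * c * (96 * c * exp (- C / 2) + 2) + 4"
  have c: "2 \<le> c" by (simp add: c_def)
  have K: "0 \<le> K" using c by (simp add: K_def)
  let ?G = "\<lambda>n. {\<omega> \<in> space (hrg_measure \<alpha> C n). \<forall>a\<in>UNIV. \<bar>real (sector_degree_sum C n \<omega> a (\<phi> n))\<bar>
    \<le> K * ln (real n) ^ 3 * \<bar>\<phi> n * real n + real (hrg_max_degree C n \<omega>)\<bar>}"
  \<comment> \<open>The second threshold ensures \<open>2 \<le> R\<close>; the first makes powers of
    \<open>ln n\<close> increasing in the exponent.\<close>
  have "eventually (\<lambda>n. max 1 ((2 + \<bar>C\<bar>) / 2) \<le> ln (real n)) sequentially"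
    using filterlim_compose[OF ln_at_top filterlim_real_sequentially]
    unfolding filterlim_at_top by blast
  hence "eventually (\<lambda>n. norm (1 - measure (hrg_measure \<alpha> C n) (?G n)) \<le> 2 * norm (1 / real n)) sequentially"
    using eventually_gt_at_top[of 0]
  proof eventually_elim
    case (elim n)
    define l where "l = ln (real n)"
    have l: "1 \<le> l" and n: "0 < n" using elim by (auto simp: l_def)
    define R where "R = hrg_radius C n"
    have R: "2 \<le> R" using elim by (simp add: R_def hrg_radius_def abs_if split: if_splits)
    have R_le: "R \<le> c * l"
    proof -
      have "C \<le> \<bar>C\<bar> * l" using mult_left_mono[OF l, of "\<bar>C\<bar>"] by simp
      thus ?thesis by (simp add: R_def hrg_radius_def c_def l_def algebra_simps)
    qed
    define L where "L = 96 * real n * R * exp (- R / 2) + 2 * l"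
    \<comment> \<open>With \<open>R = 2 * ln n + C\<close> the factor \<open>n\<close> cancels, so
      \<open>L\<close> is only logarithmic in \<open>n\<close>.\<close>
    have nR: "real n * exp (- R / 2) = exp (- C / 2)"
    proof -
      have "- R / 2 = - ln (real n) + - C / 2" by (simp add: R_def hrg_radius_def field_simps)
      thus ?thesis using n by (simp add: exp_diff exp_minus exp_add inverse_eq_divide)
    qed
    have L_eq: "L = 96 * exp (- C / 2) * R + 2 * l"
    proof -
      have "96 * real n * R * exp (- R / 2) = 96 * (real n * exp (- R / 2)) * R" by simp
      thus ?thesis unfolding L_def nR by simp
    qed
    have L0: "0 \<le> L" using R l by (simp add: L_eq)
    have "L \<le> 96 * exp (- C / 2) * (c * l) + 2 * l"
      unfolding L_eq using R_le by (intro add_right_mono mult_left_mono) auto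
    hence L_le: "L \<le> (96 * c * exp (- C / 2) + 2) * l" by (simp add: algebra_simps)
    interpret prob_space "hrg_measure \<alpha> C n"
      unfolding hrg_measure_def using assms R
      by (intro prob_space_PiM prob_space_pair prob_space_radial prob_space_angular) (auto simp: R_def)
    have bound: "8 * real n * \<phi> n * L * R * (1 + l) + (3 * l + 1) * D
        \<le> K * l ^ 3 * (\<phi> n * real n + D)" if "0 \<le> D" for D
    proof -
      \<comment> \<open>The exponent 3 arises here: one logarithm each from the degree bound
        \<open>L\<close>, the radial integration \<open>R\<close> and the harmonic sum.\<close>
      have "L * R * (1 + l) \<le> ((96 * c * exp (- C / 2) + 2) * l) * (c * l) * (2 * l)"
        using L_le R_le L0 R l c by (intro mult_mono) auto
      also have "8 * \<dots> = (16 * c * (96 * c * exp (- C / 2) + 2)) * l ^ 3"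
        by (simp add: power3_eq_cube)
      also have "\<dots> \<le> K * l ^ 3" using l by (intro mult_right_mono) (auto simp: K_def)
      finally have "8 * (L * R * (1 + l)) \<le> K * l ^ 3" by simp
      from mult_right_mono[OF this, of "\<phi> n * real n"] assms(3)[of n]
      have 1: "8 * real n * \<phi> n * L * R * (1 + l) \<le> K * l ^ 3 * (\<phi> n * real n)"
        by (simp add: mult_ac)
      have "3 * l + 1 \<le> 4 * l" using l by simp
      also have "\<dots> \<le> K * l ^ 3"
        using l c power_increasing[of 1 3 l] by (intro mult_mono) (auto simp: K_def)
      finally have "(3 * l + 1) * D \<le> K * l ^ 3 * D" using that by (rule mult_right_mono)
      with 1 show ?thesis by (simp add: distrib_left)
    qed
    have G_eq: "?G n = {\<omega> \<in> space (hrg_measure \<alpha> C n). \<forall>a. real (sector_degree_sum C n \<omega> a (\<phi> n))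
        \<le> K * l ^ 3 * (\<phi> n * real n) + K * l ^ 3 * real (hrg_max_degree C n \<omega>)}"
      using assms(3)[of n] by (simp add: l_def distrib_left)
    have G_sets: "?G n \<in> events"
      unfolding G_eq using n K l assms(3)[of n] by (intro sets_sector_degree_sums_le) auto
    have "1 - 2 / real n \<le> prob {\<omega> \<in> space (hrg_measure \<alpha> C n). \<forall>a. real (sector_degree_sum C n \<omega> a (\<phi> n)) \<le>
        8 * real n * \<phi> n * L * R * (1 + l) + (3 * l + 1) * real (hrg_max_degree C n \<omega>)}"
      using prob_sector_degree_sums_le[OF assms(1,2) assms(3)[of n] n, of C] R
      unfolding R_def L_def l_def by simp
    also have "\<dots> \<le> prob (?G n)"
    proof (rule finite_measure_mono[OF _ G_sets])
      show "{\<omega> \<in> space (hrg_measure \<alpha> C n). \<forall>a. real (sector_degree_sum C n \<omega> a (\<phi> n)) \<le>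
          8 * real n * \<phi> n * L * R * (1 + l) + (3 * l + 1) * real (hrg_max_degree C n \<omega>)} \<subseteq> ?G n"
        unfolding G_eq using bound[OF of_nat_0_le_iff]
        by (auto simp: distrib_left) (meson order_trans)
    qed
    finally show ?case using prob_le_1[of "?G n"] by simp
  qed
  hence "whp (hrg_measure \<alpha> C) (\<lambda>n \<omega>. \<forall>a\<in>UNIV. \<bar>real (sector_degree_sum C n \<omega> a (\<phi> n))\<bar>
      \<le> K * ln (real n) ^ 3 * \<bar>\<phi> n * real n + real (hrg_max_degree C n \<omega>)\<bar>)"
    unfolding whp_def by (rule bigoI)
  thus ?thesis unfolding whp_soft_O_def by blast
qed

end
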